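(* Let $E$ be a nonzero real Banach space and let $S : E \rightrightarrows E^*$ be maximally monotone. Then $S$ is quasidense if and only if $${\varphi_S}^*(y^*,y^{**}) \ge \langle y^*, y^{**}\rangle \quad \text{for all } (y^*,y^{**}) \in E^* \times E^{**}.$$
   Context: For a multifunction $S : E \rightrightarrows E^*$, $G(S) := \{(x,x^* ) : x^* \in Sx\}$ is its graph; $S$ is (maximally) monotone if $G(S)$ is a (maximally) monotone subset of $E \times E^*$. $S$ is quasidense if, for all $(x,x^* ) \in E \times E^*$, $\inf_{(s,s^* ) \in G(S)}\big[\frac12\|s-x\|^2 + \frac12\|s^*-x^*\|^2 + \langle s-x, s^*-x^*\rangle\big] \le 0$. The Fitzpatrick function of $S$ is $\varphi_S(x,x^* ) := \sup_{(s,s^* ) \in G(S)}[\langle s, x^*\rangle + \langle x, s^*\rangle - \langle s, s^*\rangle]$ on $E \times E^*$, and its Fenchel conjugate, on $E^* \times E^{**}$, is ${\varphi_S}^*(y^*,y^{**}) := \sup_{(x,x^* ) \in E \times E^*}[\langle x, y^*\rangle + \langle x^*, y^{**}\rangle - \varphi_S(x,x^* )]$. *)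

theory Defs
  imports "HOL-Analysis.Analysis"
begin

text \<open>The Banach dual of a real normed space is the library's space of bounded linear
  functionals with the operator norm; the bidual is its dual.\<close>

type_synonym 'a dual = "'a \<Rightarrow>\<^sub>L real"

type_synonym 'a multifun = "'a \<Rightarrow> 'a dual set"

definition pairing :: "'a::real_normed_vector \<Rightarrow> 'a dual \<Rightarrow> real"  (\<open>\<langle>_,/ _\<rangle>\<close>)
  where "\<langle>x, f\<rangle> = blinfun_apply f x"

definition graph_of :: "'a::real_normed_vector multifun \<Rightarrow> ('a \<times> 'a dual) set"
  where "graph_of S = {(x, f). f \<in> S x}"

definition monotone_set :: "('a::real_normed_vector \<times> 'a dual) set \<Rightarrow> bool"
  where "monotone_set A \<longleftrightarrow>
    (\<forall>(x, f) \<in> A. \<forall>(y, g) \<in> A. \<langle>x - y, f - g\<rangle> \<ge> 0)"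

definition maximally_monotone_set :: "('a::real_normed_vector \<times> 'a dual) set \<Rightarrow> bool"
  where "maximally_monotone_set A \<longleftrightarrow>
    monotone_set A \<and> (\<forall>B. monotone_set B \<and> A \<subseteq> B \<longrightarrow> B = A)"

definition maximally_monotone :: "'a::real_normed_vector multifun \<Rightarrow> bool"
  where "maximally_monotone S \<longleftrightarrow> maximally_monotone_set (graph_of S)"

text \<open>Infima and suprema are taken in the extended reals, so that an infimum over an empty
  graph is \<open>\<infinity>\<close> and unbounded suprema are \<open>\<infinity>\<close>.\<close>

definition quasidense :: "'a::real_normed_vector multifun \<Rightarrow> bool"
  where "quasidense S \<longleftrightarrow>
    (\<forall>x f. (INF (s, g) \<in> graph_of S.
        ereal ((norm (s - x))\<^sup>2 / 2 + (norm (g - f))\<^sup>2 / 2 + \<langle>s - x, g - f\<rangle>)) \<le> 0)"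

definition fitzpatrick :: "'a::real_normed_vector multifun \<Rightarrow> 'a \<Rightarrow> 'a dual \<Rightarrow> ereal"
  where "fitzpatrick S x f =
    (SUP (s, g) \<in> graph_of S. ereal (\<langle>s, f\<rangle> + \<langle>x, g\<rangle> - \<langle>s, g\<rangle>))"

text \<open>The conjugate of a function on \<open>E \<times> E\<^sup>*\<close>, with the dual of \<open>E \<times> E\<^sup>*\<close> identified
  with \<open>E\<^sup>* \<times> E\<^sup>*\<^sup>*\<close>. The minuend is always finite, so no \<open>\<infinity> - \<infinity>\<close> occurs.\<close>

definition fenchel_conjugate ::
    "('a::real_normed_vector \<Rightarrow> 'a dual \<Rightarrow> ereal) \<Rightarrow> 'a dual \<Rightarrow> 'a dual dual \<Rightarrow> ereal"
  where "fenchel_conjugate \<phi> f F =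
    (SUP (x, g) \<in> UNIV. ereal (\<langle>x, f\<rangle> + \<langle>g, F\<rangle>) - \<phi> x g)"

end

theory Submission
  imports Defs
begin

text \<open>
  Write \<open>q b = \<langle>x, f\<rangle>\<close> for \<open>b = (x, f)\<close> in \<open>E \<times> E\<^sup>*\<close>, let \<open>[a, b]\<close> be the symmetric bilinear
  form with \<open>[b, b] = 2 q b\<close>, and give \<open>E \<times> E\<^sup>*\<close> the Euclidean product norm. Then
  \<open>r b = \<parallel>b\<parallel>\<^sup>2 / 2 + q b\<close> is nonnegative, and quasidensity of the graph \<open>A\<close> says that
  \<open>r (a - b)\<close> gets arbitrarily small as \<open>a\<close> ranges over \<open>A\<close>, for each \<open>b\<close>. Maximal
  monotonicity enters only through the Fitzpatrick function \<open>\<phi>\<close>: it is proper, convex and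
  lower semicontinuous, \<open>\<phi> \<ge> q\<close> everywhere, and \<open>\<phi> = q\<close> exactly on \<open>A\<close>.

  Quasidensity implies the inequality for the conjugate. Since \<open>\<phi> \<le> q\<close> on \<open>A\<close>, the conjugate
  at \<open>(f, F)\<close> is at least \<open>\<langle>s, f\<rangle> + \<langle>g, F\<rangle> - \<langle>s, g\<rangle>\<close> for each \<open>(s, g)\<close> in \<open>A\<close>. Choose \<open>z\<close> in
  \<open>E\<^sup>*\<close> with \<open>\<parallel>z\<parallel>\<^sup>2 / 2 + \<langle>z, F\<rangle>\<close> close to its infimum \<open>- \<parallel>F\<parallel>\<^sup>2 / 2\<close>. A point of \<open>A\<close> with
  \<open>r (a - (0, f - z))\<close> small then makes this value almost \<open>\<langle>f, F\<rangle>\<close>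
  (\<open>quasidense_imp_conjugate_ge\<close>).

  The converse has two steps. First, \<open>\<phi> c - q c + r (c - b)\<close> gets arbitrarily small for each
  \<open>b\<close> (\<open>conjugate_ge_imp_approx\<close>). As a function of \<open>d = c - b\<close> this expression is
  \<open>g d + \<parallel>d\<parallel>\<^sup>2 / 2\<close> with \<open>g\<close> the Fitzpatrick function of the translate \<open>A - b\<close>. If its infimum
  were positive, Fenchel duality would give a functional \<open>(y, Y)\<close> with
  \<open>g\<^sup>*(y, Y) < - \<parallel>y\<parallel>\<^sup>2 / 2 - \<parallel>Y\<parallel>\<^sup>2 / 2 \<le> \<langle>y, Y\<rangle>\<close>, and translating back would contradict the
  hypothesis. The duality theorem (\<open>half_norm_sq_duality\<close>) rests on a form of the Hahn-Banach
  theorem for convex functions.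

  Second, one moves from a point where \<open>\<phi> - q\<close> is small to a nearby point where it vanishes,
  that is, to a point of \<open>A\<close> (\<open>small_gap_near_graph\<close>). Applying the first step repeatedly, with
  each point serving as the next \<open>b\<close>, gives a sequence along which \<open>\<phi> - q\<close> tends to \<open>0\<close>. It is
  Cauchy because convexity of \<open>\<phi>\<close> together with \<open>\<phi> \<ge> q\<close> bounds \<open>- q\<close> of a difference by the
  values of \<open>\<phi> - q\<close> at its two ends (\<open>gap_controls_duality_form\<close>), while \<open>r\<close> of that difference is
  small by construction. Completeness and lower semicontinuity of \<open>\<phi>\<close> finish the argument.
\<close>

section \<open>Linear minorants of convex functions\<close>

text \<open>If \<open>h\<close> is convex with \<open>h 0 = 0\<close> then \<open>x \<mapsto> h (t x) / t\<close>, for \<open>0 < t < 1\<close>, is a convex function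
  below \<open>h\<close>, so minimality makes \<open>h\<close> positively homogeneous and hence subadditive. Then
  \<open>x \<mapsto> h (x + y) - h y\<close> is a convex function below \<open>h\<close> as well, and minimality makes \<open>h\<close>
  additive.\<close>

lemma minimal_convex_is_linear:
  fixes h :: "'v::real_vector \<Rightarrow> real"
  assumes conv: "convex_on UNIV h" and zero: "h 0 = 0"
    and min: "\<And>g. convex_on UNIV g \<Longrightarrow> g 0 = 0 \<Longrightarrow> g \<le> h \<Longrightarrow> g = h"
  shows "linear h"
proof -
  have convD: "h (u *\<^sub>R x + v *\<^sub>R y) \<le> u * h x + v * h y"
    if "0 \<le> u" "0 \<le> v" "u + v = 1" for u v x y
    using conv that unfolding convex_on_def by auto
  have small: "h (t *\<^sub>R x) = t * h x" if t: "0 < t" "t < 1" for t x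
  proof -
    have "(\<lambda>x. h (t *\<^sub>R x) / t) = h"
    proof (rule min)
      show "convex_on UNIV (\<lambda>x. h (t *\<^sub>R x) / t)"
      proof (rule convex_onI)
        fix s :: real and x y :: 'v
        assume s: "0 < s" "s < 1"
        have "h (t *\<^sub>R ((1 - s) *\<^sub>R x + s *\<^sub>R y)) = h ((1 - s) *\<^sub>R (t *\<^sub>R x) + s *\<^sub>R (t *\<^sub>R y))"
          by (simp add: algebra_simps)
        also have "\<dots> \<le> (1 - s) * h (t *\<^sub>R x) + s * h (t *\<^sub>R y)"
          using s by (intro convD) auto
        finally show "h (t *\<^sub>R ((1 - s) *\<^sub>R x + s *\<^sub>R y)) / t
            \<le> (1 - s) * (h (t *\<^sub>R x) / t) + s * (h (t *\<^sub>R y) / t)"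
          using t by (simp add: field_simps)
      qed simp
      show "h (t *\<^sub>R 0) / t = 0" by (simp add: zero)
      show "(\<lambda>x. h (t *\<^sub>R x) / t) \<le> h"
      proof (rule le_funI)
        fix x
        have "h (t *\<^sub>R x + (1 - t) *\<^sub>R 0) \<le> t * h x + (1 - t) * h 0"
          using t by (intro convD) auto
        then show "h (t *\<^sub>R x) / t \<le> h x"
          using t by (simp add: zero field_simps)
      qed
    qed
    from fun_cong[OF this, of x] show ?thesis using t by (simp add: field_simps)
  qed
  have pos: "h (t *\<^sub>R x) = t * h x" if "0 < t" for t x
  proof (cases "t < 1")
    case True
    then show ?thesis using small that by simp
  next
    case False
    then consider "t = 1" | "t > 1" by linarith
    then show ?thesis
    proof cases
      case 2
      then show ?thesis using small[of "1 / t" "t *\<^sub>R x"] by (simp add: field_simps)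
    qed simp
  qed
  have sub: "h (x + y) \<le> h x + h y" for x y
  proof -
    have "h ((1/2) *\<^sub>R (2 *\<^sub>R x) + (1/2) *\<^sub>R (2 *\<^sub>R y)) \<le> 1/2 * h (2 *\<^sub>R x) + 1/2 * h (2 *\<^sub>R y)"
      by (intro convD) auto
    then show ?thesis using pos[of 2 x] pos[of 2 y] by simp
  qed
  have add: "h (x + y) = h x + h y" for x y
  proof -
    have "(\<lambda>x. h (x + y) - h y) = h"
    proof (rule min)
      show "convex_on UNIV (\<lambda>x. h (x + y) - h y)"
      proof (rule convex_onI)
        fix s :: real and a b :: 'v
        assume s: "0 < s" "s < 1"
        have "h ((1 - s) *\<^sub>R a + s *\<^sub>R b + y) = h ((1 - s) *\<^sub>R (a + y) + s *\<^sub>R (b + y))"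
          by (simp add: algebra_simps)
        also have "\<dots> \<le> (1 - s) * h (a + y) + s * h (b + y)"
          using s by (intro convD) auto
        finally show "h ((1 - s) *\<^sub>R a + s *\<^sub>R b + y) - h y
            \<le> (1 - s) * (h (a + y) - h y) + s * (h (b + y) - h y)"
          by (simp add: algebra_simps)
      qed simp
      show "(\<lambda>x. h (x + y) - h y) \<le> h"
        using sub by (auto simp: le_fun_def algebra_simps)
    qed simp
    from fun_cong[OF this, of x] show ?thesis by simp
  qed
  have neg: "h (- x) = - h x" for x
    using add[of x "- x"] zero by simp
  show "linear h"
  proof (rule linearI)
    show "h (x + y) = h x + h y" for x y by (rule add)
    fix r :: real and x
    consider "r > 0" | "r = 0" | "r < 0" by linarith
    then show "h (r *\<^sub>R x) = r *\<^sub>R h x"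
    proof cases
      case 3
      then show ?thesis using pos[of "- r" "x"] neg[of "r *\<^sub>R x"] by simp
    qed (auto simp: zero pos)
  qed
qed

text \<open>The Hahn-Banach theorem for convex functions. Zorn's lemma, applied downwards, gives a
  minimal convex function below \<open>p\<close>; chains have lower bounds because convexity at the midpoint
  of \<open>x\<close> and \<open>- x\<close> keeps each member above \<open>- p (- x)\<close>.\<close>

theorem convex_has_linear_minorant:
  fixes p :: "'v::real_vector \<Rightarrow> real"
  assumes conv: "convex_on UNIV p" and zero: "p 0 = 0"
  shows "\<exists>f. linear f \<and> (\<forall>x. f x \<le> p x)"
proof -
  define Q where "Q = {h. convex_on UNIV h \<and> h 0 = 0 \<and> h \<le> p}"
  have lower: "- p (- x) \<le> h x" if "h \<in> Q" for h x
  proof -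
    have "h ((1/2) *\<^sub>R x + (1/2) *\<^sub>R (- x)) \<le> 1/2 * h x + 1/2 * h (- x)"
      using convex_onD[of UNIV h "1/2" x "- x"] that by (simp add: Q_def)
    moreover have "h (- x) \<le> p (- x)" using that by (auto simp: Q_def le_fun_def)
    ultimately show ?thesis using that by (simp add: Q_def)
  qed
  have "\<exists>m\<in>Q. \<forall>a\<in>Q. m \<ge> a \<longrightarrow> a = m"
  proof (rule predicate_Zorn)
    show "partial_order_on Q (relation_of (\<ge>) Q)"
      by (rule partial_order_on_relation_ofI) auto
  next
    fix C assume C: "C \<in> Chains (relation_of (\<ge>) Q)"
    then have sub: "C \<subseteq> Q" by (auto simp: Chains_def relation_of_def)
    have total: "a \<le> b \<or> b \<le> a" if "a \<in> C" "b \<in> C" for a b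
      using C that by (auto simp: Chains_def relation_of_def)
    show "\<exists>u\<in>Q. \<forall>a\<in>C. a \<ge> u"
    proof (cases "C = {}")
      case True
      then show ?thesis using conv zero by (auto simp: Q_def)
    next
      case False
      define u where "u x = (INF h\<in>C. h x)" for x
      have bdd: "bdd_below ((\<lambda>h. h x) ` C)" for x
        using lower sub by (intro bdd_belowI2[where m = "- p (- x)"]) auto
      have le: "u x \<le> h x" if "h \<in> C" for h x
        unfolding u_def by (rule cINF_lower[OF bdd that])
      have "u \<in> Q"
      proof -
        have "convex_on UNIV u"
        proof (rule convex_onI)
          fix t :: real and x y :: 'v
          assume t: "0 < t" "t < 1"
          show "u ((1 - t) *\<^sub>R x + t *\<^sub>R y) \<le> (1 - t) * u x + t * u y"
          proof (rule field_le_epsilon)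
            fix e :: real assume e: "0 < e"
            obtain h1 where h1: "h1 \<in> C" "h1 x < u x + e"
              using cINF_less_iff[OF False bdd, of x "u x + e"] e unfolding u_def by auto
            obtain h2 where h2: "h2 \<in> C" "h2 y < u y + e"
              using cINF_less_iff[OF False bdd, of y "u y + e"] e unfolding u_def by auto
            obtain h where h: "h \<in> C" "h \<le> h1" "h \<le> h2"
              using total[OF h1(1) h2(1)] h1(1) h2(1) by auto
            have hx: "h x \<le> u x + e" and hy: "h y \<le> u y + e"
              using h h1(2) h2(2) by (meson le_funD less_imp_le order_trans)+
            have "u ((1 - t) *\<^sub>R x + t *\<^sub>R y) \<le> h ((1 - t) *\<^sub>R x + t *\<^sub>R y)"
              by (rule le[OF h(1)])
            also have "\<dots> \<le> (1 - t) * h x + t * h y"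
              using h(1) sub t by (intro convex_onD[where A = UNIV]) (auto simp: Q_def)
            also have "\<dots> \<le> (1 - t) * (u x + e) + t * (u y + e)"
              using t hx hy by (intro add_mono mult_left_mono) auto
            finally show "u ((1 - t) *\<^sub>R x + t *\<^sub>R y) \<le> (1 - t) * u x + t * u y + e"
              by (simp add: algebra_simps)
          qed
        qed simp
        moreover have "u 0 = 0"
        proof -
          have "(\<lambda>h. h 0) ` C = {0}" using sub False by (auto simp: Q_def)
          then show ?thesis by (simp add: u_def)
        qed
        moreover have "u \<le> p"
        proof -
          obtain h where "h \<in> C" using False by auto
          then have "u \<le> h" "h \<le> p" using le sub by (auto simp: le_fun_def Q_def)
          then show ?thesis by (rule order_trans)
        qed
        ultimately show ?thesis by (simp add: Q_def)
      qed
      then show ?thesis using le by (auto simp: le_fun_def)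
    qed
  qed
  then obtain h where h: "h \<in> Q" and min: "\<And>a. a \<in> Q \<Longrightarrow> a \<le> h \<Longrightarrow> a = h" by auto
  have "linear h"
  proof (rule minimal_convex_is_linear)
    fix g :: "'v \<Rightarrow> real"
    assume "convex_on UNIV g" "g 0 = 0" "g \<le> h"
    then show "g = h" using h by (intro min) (auto simp: Q_def intro: order_trans)
  qed (use h in \<open>auto simp: Q_def\<close>)
  then show ?thesis using h by (auto simp: Q_def le_fun_def)
qed

section \<open>Duality for functions perturbed by half the squared norm\<close>

lemma bounded_functional_if_bounded_above_on_ball:
  fixes f :: "'v::real_normed_vector \<Rightarrow> real"
  assumes lin: "linear f" and bd: "\<And>x. norm x \<le> 1 \<Longrightarrow> f x \<le> M"
  shows "bounded_linear f"
proof -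
  have one: "f x \<le> M * norm x" for x
  proof (cases "x = 0")
    case False
    have "f (x /\<^sub>R norm x) \<le> M" by (rule bd) (use False in simp)
    then show ?thesis
      using False by (simp add: linear_scale[OF lin] field_simps)
  qed (simp add: linear_0[OF lin])
  have "norm (f x) \<le> norm x * M" for x
    using one[of x] one[of "- x"] by (simp add: linear_neg[OF lin] mult.commute abs_le_iff)
  then show ?thesis
    using lin by (simp add: bounded_linear_def bounded_linear_axioms_def) blast
qed

lemma norm_sq_convex:
  fixes a b :: "'v::real_normed_vector"
  assumes t: "0 \<le> t" "t \<le> 1"
  shows "(norm ((1 - t) *\<^sub>R a + t *\<^sub>R b))\<^sup>2 \<le> (1 - t) * (norm a)\<^sup>2 + t * (norm b)\<^sup>2"
proof -
  have "norm ((1 - t) *\<^sub>R a + t *\<^sub>R b) \<le> (1 - t) * norm a + t * norm b"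
    using t norm_triangle_ineq[of "(1 - t) *\<^sub>R a" "t *\<^sub>R b"] by simp
  then have "(norm ((1 - t) *\<^sub>R a + t *\<^sub>R b))\<^sup>2 \<le> ((1 - t) * norm a + t * norm b)\<^sup>2"
    by (intro power_mono) auto
  also have "\<dots> = (1 - t) * (norm a)\<^sup>2 + t * (norm b)\<^sup>2 - t * (1 - t) * (norm a - norm b)\<^sup>2"
    by (simp add: power2_eq_square algebra_simps)
  also have "\<dots> \<le> (1 - t) * (norm a)\<^sup>2 + t * (norm b)\<^sup>2"
    using t by simp
  finally show ?thesis .
qed

text \<open>The Fenchel duality theorem for the sum of a convex function and \<open>\<parallel>\<cdot>\<parallel>\<^sup>2 / 2\<close>. The
  convex function is given by a convex set \<open>C\<close> of points on or above its graph, so that it may take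
  the value \<open>\<infinity>\<close>. The infimal convolution \<open>P\<close> of the two functions is convex, everywhere finite
  and at least \<open>m\<close> at \<open>0\<close>, and \<open>c\<close> is a subgradient of \<open>P\<close> at \<open>0\<close>; it is continuous because
  \<open>P\<close> is bounded above on the unit ball. The inequality for a pair \<open>(d, r)\<close> and \<open>u\<close> is the subgradient
  inequality at \<open>d - u\<close>.\<close>

theorem half_norm_sq_duality:
  fixes C :: "('v::real_normed_vector \<times> real) set"
  assumes conv: "convex C" and ne: "C \<noteq> {}"
    and lower: "\<And>d r. (d, r) \<in> C \<Longrightarrow> m \<le> r + (norm d)\<^sup>2 / 2"
  shows "\<exists>c :: 'v \<Rightarrow>\<^sub>L real. \<forall>(d, r)\<in>C. \<forall>u. m \<le> r - c d + ((norm u)\<^sup>2 / 2 + c u)"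
proof -
  define P where "P a = (INF z\<in>C. snd z + (norm (a - fst z))\<^sup>2 / 2)" for a
  have mix: "\<exists>z\<in>C. snd z + (norm ((1 - t) *\<^sub>R a + t *\<^sub>R b - fst z))\<^sup>2 / 2
      \<le> (1 - t) * (snd z1 + (norm (a - fst z1))\<^sup>2 / 2) + t * (snd z2 + (norm (b - fst z2))\<^sup>2 / 2)"
    if z: "z1 \<in> C" "z2 \<in> C" and t: "0 \<le> t" "t \<le> 1" for a b z1 z2 t
  proof (rule bexI)
    show "(1 - t) *\<^sub>R z1 + t *\<^sub>R z2 \<in> C" using conv z t by (simp add: convex_alt)
    have eq: "(1 - t) *\<^sub>R a + t *\<^sub>R b - fst ((1 - t) *\<^sub>R z1 + t *\<^sub>R z2)
        = (1 - t) *\<^sub>R (a - fst z1) + t *\<^sub>R (b - fst z2)"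
      by (simp add: algebra_simps)
    show "snd ((1 - t) *\<^sub>R z1 + t *\<^sub>R z2)
        + (norm ((1 - t) *\<^sub>R a + t *\<^sub>R b - fst ((1 - t) *\<^sub>R z1 + t *\<^sub>R z2)))\<^sup>2 / 2
      \<le> (1 - t) * (snd z1 + (norm (a - fst z1))\<^sup>2 / 2) + t * (snd z2 + (norm (b - fst z2))\<^sup>2 / 2)"
      unfolding eq using norm_sq_convex[OF t, of "a - fst z1" "b - fst z2"]
      by (simp add: distrib_left add_divide_distrib)
  qed
  have lower': "m \<le> snd z + (norm (0 - fst z))\<^sup>2 / 2" if "z \<in> C" for z
    using lower[of "fst z" "snd z"] that by simp
  obtain z0 where z0: "z0 \<in> C" using ne by auto
  \<comment> \<open>A very negative value at \<open>a\<close>, averaged with a fixed value at \<open>- a\<close>, would give a value below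
    \<open>m\<close> at \<open>0\<close>.\<close>
  have bdd: "bdd_below ((\<lambda>z. snd z + (norm (a - fst z))\<^sup>2 / 2) ` C)" for a
  proof (rule bdd_belowI2)
    fix z assume "z \<in> C"
    from mix[OF z0 this, of "1/2" "- a" a] obtain y where
      y: "y \<in> C" "snd y + (norm ((1 - 1/2) *\<^sub>R (- a) + (1/2) *\<^sub>R a - fst y))\<^sup>2 / 2
      \<le> (1 - 1/2) * (snd z0 + (norm (- a - fst z0))\<^sup>2 / 2) + 1/2 * (snd z + (norm (a - fst z))\<^sup>2 / 2)"
      by auto
    have "m \<le> 1/2 * (snd z0 + (norm (- a - fst z0))\<^sup>2 / 2) + 1/2 * (snd z + (norm (a - fst z))\<^sup>2 / 2)"
      using lower'[OF y(1)] y(2) by simp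
    then show "2 * m - (snd z0 + (norm (- a - fst z0))\<^sup>2 / 2) \<le> snd z + (norm (a - fst z))\<^sup>2 / 2"
      by argo
  qed
  have P_le: "P a \<le> snd z + (norm (a - fst z))\<^sup>2 / 2" if "z \<in> C" for a z
    unfolding P_def by (rule cINF_lower[OF bdd that])
  have P0: "m \<le> P 0"
    unfolding P_def using lower' by (intro cINF_greatest[OF ne]) auto
  have "convex_on UNIV (\<lambda>a. P a - P 0)"
  proof (rule convex_onI)
    fix t :: real and a b :: 'v
    assume t: "0 < t" "t < 1"
    have "P ((1 - t) *\<^sub>R a + t *\<^sub>R b) \<le> (1 - t) * P a + t * P b"
    proof (rule field_le_epsilon)
      fix e :: real assume e: "0 < e"
      obtain z1 where z1: "z1 \<in> C" "snd z1 + (norm (a - fst z1))\<^sup>2 / 2 < P a + e"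
        using cINF_less_iff[OF ne bdd, of a "P a + e"] e unfolding P_def by auto
      obtain z2 where z2: "z2 \<in> C" "snd z2 + (norm (b - fst z2))\<^sup>2 / 2 < P b + e"
        using cINF_less_iff[OF ne bdd, of b "P b + e"] e unfolding P_def by auto
      obtain z where z: "z \<in> C" "snd z + (norm ((1 - t) *\<^sub>R a + t *\<^sub>R b - fst z))\<^sup>2 / 2
          \<le> (1 - t) * (snd z1 + (norm (a - fst z1))\<^sup>2 / 2) + t * (snd z2 + (norm (b - fst z2))\<^sup>2 / 2)"
        using mix[OF z1(1) z2(1), of t a b] t by auto
      have "P ((1 - t) *\<^sub>R a + t *\<^sub>R b) \<le>
          (1 - t) * (snd z1 + (norm (a - fst z1))\<^sup>2 / 2) + t * (snd z2 + (norm (b - fst z2))\<^sup>2 / 2)"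
        using P_le[OF z(1)] z(2) by (rule order_trans)
      also have "\<dots> \<le> (1 - t) * (P a + e) + t * (P b + e)"
        by (intro add_mono[OF mult_left_mono mult_left_mono]) (use t z1(2) z2(2) in auto)
      finally show "P ((1 - t) *\<^sub>R a + t *\<^sub>R b) \<le> (1 - t) * P a + t * P b + e"
        by (simp add: algebra_simps)
    qed
    then show "P ((1 - t) *\<^sub>R a + t *\<^sub>R b) - P 0 \<le> (1 - t) * (P a - P 0) + t * (P b - P 0)"
      by (simp add: algebra_simps)
  qed simp
  from convex_has_linear_minorant[OF this] obtain f
    where lin: "linear f" and f: "\<And>a. f a \<le> P a - P 0" by auto
  have "bounded_linear f"
  proof (rule bounded_functional_if_bounded_above_on_ball[OF lin])
    fix a :: 'v assume a: "norm a \<le> 1"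
    have "norm (a - fst z0) \<le> 1 + norm (fst z0)"
      using norm_triangle_ineq4[of a "fst z0"] a by linarith
    then have "(norm (a - fst z0))\<^sup>2 \<le> (1 + norm (fst z0))\<^sup>2" by (intro power_mono) auto
    then show "f a \<le> snd z0 + (1 + norm (fst z0))\<^sup>2 / 2 - P 0"
      using f[of a] P_le[OF z0, of a] by linarith
  qed
  then have app: "blinfun_apply (Blinfun f) = f" by (rule bounded_linear_Blinfun_apply)
  have "m \<le> r - f d + ((norm u)\<^sup>2 / 2 + f u)" if "(d, r) \<in> C" for d r u
    using f[of "d - u"] P_le[OF that, of "d - u"] P0 by (simp add: linear_diff[OF lin])
  then show ?thesis by (intro exI[of _ "Blinfun f"]) (auto simp: app)
qed

text \<open>Together with the bound that follows, this says that \<open>\<parallel>\<cdot>\<parallel>\<^sup>2 / 2\<close> on \<open>E\<close> has conjugate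
  \<open>\<parallel>\<cdot>\<parallel>\<^sup>2 / 2\<close> on the dual. The infimum need not be attained; an almost minimal \<open>x\<close> has the norm
  \<open>\<parallel>c\<parallel>\<close> and a direction along which \<open>- c\<close> almost attains its norm.\<close>

lemma conjugate_half_norm_sq_approx:
  fixes c :: "'v::real_normed_vector \<Rightarrow>\<^sub>L real"
  assumes e: "0 < e"
  shows "\<exists>x. (norm x)\<^sup>2 / 2 + c x \<le> - (norm c)\<^sup>2 / 2 + e"
proof (cases "c = 0")
  case True
  then show ?thesis using e by (intro exI[of _ 0]) simp
next
  case False
  define N where "N = norm c"
  have N: "N > 0" using False by (simp add: N_def)
  \<comment> \<open>Any \<open>k < N\<close> is exceeded by some ratio \<open>\<bar>c y\<bar> / \<parallel>y\<parallel>\<close>; the resulting error is \<open>N (N - k)\<close>.\<close>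
  define k where "k = max 0 (N - e / N)"
  have k: "0 \<le> k" "k < N" "N * (N - k) \<le> e"
    using N e by (auto simp: k_def field_simps max_def)
  obtain y where y: "norm (c y) > k * norm y"
    using norm_blinfun_bound[OF k(1), of c] k(2) unfolding N_def by (meson not_le)
  then have y0: "norm y > 0" using zero_less_norm_iff by fastforce
  define x where "x = (- N * sgn (c y) / norm y) *\<^sub>R y"
  have cy: "c y \<noteq> 0" using y k(1) y0 by (auto simp: mult_less_0_iff)
  have nx: "norm x = N"
    using N y0 cy by (simp add: x_def abs_mult abs_sgn_eq)
  have "c x = - N * (\<bar>c y\<bar> / norm y)"
    by (simp add: x_def blinfun.scaleR_right blinfun.minus_right abs_sgn mult.commute)
  moreover have "k \<le> \<bar>c y\<bar> / norm y" using y y0 by (simp add: field_simps)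
  ultimately have "c x \<le> - N * k" using N by (simp del: times_divide_eq_right)
  then have "(norm x)\<^sup>2 / 2 + c x \<le> - N\<^sup>2 / 2 + N * (N - k)"
    by (simp add: nx power2_eq_square algebra_simps)
  then show ?thesis using k(3) by (intro exI[of _ x]) (simp add: N_def)
qed

lemma conjugate_half_norm_sq_lower:
  fixes c :: "'v::real_normed_vector \<Rightarrow>\<^sub>L real"
  shows "- (norm c)\<^sup>2 / 2 \<le> (norm x)\<^sup>2 / 2 + c x"
proof -
  have "- (norm c * norm x) \<le> c x"
    using norm_blinfun[of c x] by (simp add: abs_le_iff)
  moreover have "0 \<le> (norm c - norm x)\<^sup>2" by simp
  ultimately show ?thesis by (simp add: power2_diff)
qed

section \<open>The duality form on the product space\<close>

definition duality_form :: "'a::real_normed_vector \<times> 'a dual \<Rightarrow> real"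
  where "duality_form b = \<langle>fst b, snd b\<rangle>"

definition duality_bracket :: "'a::real_normed_vector \<times> 'a dual \<Rightarrow> 'a \<times> 'a dual \<Rightarrow> real"
  where "duality_bracket a b = \<langle>fst a, snd b\<rangle> + \<langle>fst b, snd a\<rangle>"

lemma duality_form_add:
  "duality_form (a + b) = duality_form a + duality_bracket a b + duality_form b"
  by (simp add: duality_form_def duality_bracket_def pairing_def blinfun.add_left blinfun.add_right)

lemma duality_form_scaleR: "duality_form (t *\<^sub>R a) = t\<^sup>2 * duality_form a"
  by (simp add: duality_form_def pairing_def blinfun.scaleR_left blinfun.scaleR_right power2_eq_square)

lemma duality_form_diff:
  "duality_form (a - b) = duality_form a - duality_bracket a b + duality_form b"
  by (simp add: duality_form_def duality_bracket_def pairing_def blinfun.diff_left blinfun.diff_right)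

lemma duality_bracket_linear:
  "duality_bracket a (b + c) = duality_bracket a b + duality_bracket a c"
  "duality_bracket a (b - c) = duality_bracket a b - duality_bracket a c"
  "duality_bracket (a - b) c = duality_bracket a c - duality_bracket b c"
  "duality_bracket a (t *\<^sub>R b) = t * duality_bracket a b"
  by (simp_all add: duality_bracket_def pairing_def blinfun.add_left blinfun.add_right
      blinfun.diff_left blinfun.diff_right blinfun.scaleR_left blinfun.scaleR_right algebra_simps)

lemma duality_bracket_commute: "duality_bracket a b = duality_bracket b a"
  by (simp add: duality_bracket_def)

lemma duality_bracket_self: "duality_bracket a a = 2 * duality_form a"
  by (simp add: duality_bracket_def duality_form_def)

lemma norm_prod_sq: "(norm (b :: 'a::real_normed_vector \<times> 'b::real_normed_vector))\<^sup>2
    = (norm (fst b))\<^sup>2 + (norm (snd b))\<^sup>2"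
  by (simp add: norm_prod_def)

lemma abs_duality_form_le: "\<bar>duality_form b\<bar> \<le> (norm b)\<^sup>2 / 2"
proof -
  have "\<bar>duality_form b\<bar> \<le> norm (snd b) * norm (fst b)"
    using norm_blinfun[of "snd b" "fst b"] by (simp add: duality_form_def pairing_def)
  moreover have "0 \<le> (norm (snd b) - norm (fst b))\<^sup>2" by simp
  ultimately show ?thesis unfolding norm_prod_sq by (simp add: power2_diff)
qed

lemma abs_duality_bracket_le: "\<bar>duality_bracket a b\<bar> \<le> norm a * norm b"
proof -
  have "\<bar>duality_bracket a b\<bar> \<le> norm (fst a) * norm (snd b) + norm (snd a) * norm (fst b)"
    using norm_blinfun[of "snd b" "fst a"] norm_blinfun[of "snd a" "fst b"]
    by (simp add: duality_bracket_def pairing_def mult.commute)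
  also have "\<dots> \<le> sqrt ((norm a)\<^sup>2 * (norm b)\<^sup>2)"
  proof (rule real_le_rsqrt)
    have "0 \<le> (norm (fst a) * norm (fst b) - norm (snd a) * norm (snd b))\<^sup>2" by simp
    then show "(norm (fst a) * norm (snd b) + norm (snd a) * norm (fst b))\<^sup>2 \<le> (norm a)\<^sup>2 * (norm b)\<^sup>2"
      unfolding norm_prod_sq by (simp add: power2_eq_square algebra_simps)
  qed
  also have "\<dots> = norm a * norm b" by (simp add: real_sqrt_mult)
  finally show ?thesis .
qed

lemma tendsto_duality_form:
  assumes "(X \<longlongrightarrow> a) F" shows "((\<lambda>n. duality_form (X n)) \<longlongrightarrow> duality_form a) F"
  unfolding duality_form_def pairing_def using assms by (intro tendsto_intros) auto

lemma tendsto_duality_bracket: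
  assumes "(X \<longlongrightarrow> a) F" shows "((\<lambda>n. duality_bracket s (X n)) \<longlongrightarrow> duality_bracket s a) F"
  unfolding duality_bracket_def pairing_def using assms by (intro tendsto_intros) auto

section \<open>The epigraph of the Fitzpatrick function\<close>

text \<open>The epigraph consists of pairs with a real second component. Working with it rather than
  with the extended real values confines the infinite ones to the lemmas that connect it to
  \<open>fitzpatrick\<close> and \<open>fenchel_conjugate\<close>.\<close>

definition fitzpatrick_epigraph ::
    "('a::real_normed_vector \<times> 'a dual) set \<Rightarrow> (('a \<times> 'a dual) \<times> real) set"
  where "fitzpatrick_epigraph A = {(b, r). \<forall>s\<in>A. duality_bracket s b - duality_form s \<le> r}"

lemma fitzpatrick_epigraphD:
  "(b, r) \<in> fitzpatrick_epigraph A \<Longrightarrow> s \<in> A \<Longrightarrow> duality_bracket s b - duality_form s \<le> r"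
  by (auto simp: fitzpatrick_epigraph_def)

lemma fitzpatrick_le_iff:
  "fitzpatrick S x f \<le> ereal r \<longleftrightarrow> ((x, f), r) \<in> fitzpatrick_epigraph (graph_of S)"
  by (auto simp: fitzpatrick_def fitzpatrick_epigraph_def SUP_le_iff duality_bracket_def
      duality_form_def)

lemma monotone_set_iff:
  "monotone_set A \<longleftrightarrow> (\<forall>a\<in>A. \<forall>b\<in>A. 0 \<le> duality_form (a - b))"
  by (simp add: monotone_set_def duality_form_def case_prod_beta)

lemma monotone_graph_in_epigraph:
  assumes "monotone_set A" "a \<in> A"
  shows "(a, duality_form a) \<in> fitzpatrick_epigraph A"
proof -
  have "duality_bracket s a - duality_form s \<le> duality_form a" if "s \<in> A" for s
  proof -
    have "0 \<le> duality_form (s - a)" using assms that by (simp add: monotone_set_iff)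
    then show ?thesis by (simp add: duality_form_diff)
  qed
  then show ?thesis by (simp add: fitzpatrick_epigraph_def)
qed

text \<open>At \<open>b\<close>, the inequality \<open>[s, b] - q s \<le> q b\<close> for all \<open>s\<close> in \<open>A\<close> says that \<open>b\<close> is
  monotonically related to \<open>A\<close>, so that \<open>A\<close> with \<open>b\<close> added is still monotone.\<close>

lemma maximally_monotone_memI:
  assumes max: "maximally_monotone_set A"
    and le: "(b, duality_form b) \<in> fitzpatrick_epigraph A"
  shows "b \<in> A"
proof -
  have mono: "monotone_set A" using max by (simp add: maximally_monotone_set_def)
  have 1: "0 \<le> duality_form (s - b)" if "s \<in> A" for s
    using fitzpatrick_epigraphD[OF le that] by (simp add: duality_form_diff)
  moreover have "duality_form (b - s) = duality_form (s - b)" for s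
    by (simp add: duality_form_diff duality_bracket_commute)
  moreover have "duality_form (b - b) = 0"
    by (simp add: duality_form_def pairing_def)
  ultimately have "monotone_set (insert b A)"
    using mono by (auto simp: monotone_set_iff)
  then have "insert b A = A"
    using max by (auto simp: maximally_monotone_set_def)
  then show ?thesis by auto
qed

text \<open>A value below \<open>q b\<close> would put \<open>b\<close> into \<open>A\<close>, and then the term for \<open>s = b\<close> in the supremum
  is \<open>q b\<close> itself.\<close>

lemma duality_form_le_fitzpatrick:
  assumes max: "maximally_monotone_set A" and b: "(b, r) \<in> fitzpatrick_epigraph A"
  shows "duality_form b \<le> r"
proof (rule ccontr)
  assume "\<not> ?thesis"
  then have r: "r < duality_form b" by simp
  then have "(b, duality_form b) \<in> fitzpatrick_epigraph A"
    using b by (force simp: fitzpatrick_epigraph_def)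
  then have "b \<in> A" by (rule maximally_monotone_memI[OF max])
  then show False
    using fitzpatrick_epigraphD[OF b] r by (fastforce simp: duality_bracket_self)
qed

lemma maximally_monotone_nonempty:
  assumes "maximally_monotone_set A"
  shows "A \<noteq> {}"
proof
  assume "A = {}"
  moreover have "monotone_set {(0, 0)}" by (simp add: monotone_set_def pairing_def)
  ultimately show False using assms by (auto simp: maximally_monotone_set_def)
qed

lemma convex_fitzpatrick_epigraph: "convex (fitzpatrick_epigraph A)"
proof (rule convexI)
  fix x y :: "('a \<times> 'a dual) \<times> real" and u v :: real
  assume x: "x \<in> fitzpatrick_epigraph A" and y: "y \<in> fitzpatrick_epigraph A"
    and uv: "0 \<le> u" "0 \<le> v" "u + v = 1"
  have "duality_bracket s (u *\<^sub>R fst x + v *\<^sub>R fst y) - duality_form s \<le> u * snd x + v * snd y"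
    if s: "s \<in> A" for s
  proof -
    have "u * (duality_bracket s (fst x) - duality_form s)
        + v * (duality_bracket s (fst y) - duality_form s) \<le> u * snd x + v * snd y"
      using fitzpatrick_epigraphD[OF _ s] x y uv by (intro add_mono mult_left_mono) auto
    moreover have "u * duality_form s + v * duality_form s = duality_form s"
      using uv(3) by (metis distrib_right mult_1)
    ultimately show ?thesis
      by (simp add: duality_bracket_linear right_diff_distrib)
  qed
  then show "u *\<^sub>R x + v *\<^sub>R y \<in> fitzpatrick_epigraph A"
    by (cases x; cases y) (simp add: fitzpatrick_epigraph_def)
qed

section \<open>From a small gap to a point of the graph\<close>

text \<open>Evaluate \<open>\<phi> \<ge> q\<close> at the midpoint of \<open>b\<close> and \<open>c\<close>, bounding \<open>\<phi>\<close> there by convexity, and use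
  the parallelogram identity
  \<open>4 q ((b + c) / 2) = 2 q b + 2 q c - q (c - b)\<close>.\<close>

lemma gap_controls_duality_form:
  assumes max: "maximally_monotone_set A"
    and b: "(b, r) \<in> fitzpatrick_epigraph A" and c: "(c, t) \<in> fitzpatrick_epigraph A"
  shows "- duality_form (c - b) \<le> 2 * (r - duality_form b) + 2 * (t - duality_form c)"
proof -
  have "(1/2) *\<^sub>R (b, r) + (1/2) *\<^sub>R (c, t) \<in> fitzpatrick_epigraph A"
    using convexD[OF convex_fitzpatrick_epigraph b c, of "1/2" "1/2"] by simp
  then have "((1/2) *\<^sub>R (b + c), (r + t) / 2) \<in> fitzpatrick_epigraph A"
    by (simp add: scaleR_add_right add_divide_distrib)
  from duality_form_le_fitzpatrick[OF max this]
  show ?thesis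
    by (simp add: duality_form_scaleR duality_form_add duality_form_diff duality_bracket_commute
        power2_eq_square)
qed

text \<open>The gaps \<open>r - q b\<close> are made to decrease like \<open>4\<^sup>-\<^sup>n\<close>. A step from gap \<open>e n\<close> to gap
  \<open>e (Suc n)\<close> has squared length at most \<open>10 e n\<close>, so the step lengths decrease like \<open>2\<^sup>-\<^sup>n\<close>,
  starting at \<open>\<eta>\<close>; their sum is at most \<open>2 \<eta>\<close>. In the limit the gap is zero.\<close>

lemma small_gap_near_graph:
  fixes A :: "('a::banach \<times> 'a dual) set"
  assumes max: "maximally_monotone_set A"
    and approx: "\<And>b e. 0 < e \<Longrightarrow> \<exists>c t. (c, t) \<in> fitzpatrick_epigraph A \<and>
      t - duality_form c + ((norm (c - b))\<^sup>2 / 2 + duality_form (c - b)) < e"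
    and eta: "0 < \<eta>"
    and b: "(b, r) \<in> fitzpatrick_epigraph A" "r - duality_form b \<le> \<eta>\<^sup>2 / 10"
  shows "\<exists>a\<in>A. norm (a - b) \<le> 2 * \<eta>"
proof -
  define e where "e n = \<eta>\<^sup>2 / 10 * (1/4)^n" for n :: nat
  have e_pos: "0 < e n" for n using eta by (simp add: e_def)
  have e_Suc: "e (Suc n) \<le> e n" for n using eta by (simp add: e_def)
  have e_lim: "e \<longlonglongrightarrow> 0"
    unfolding e_def by (rule tendsto_mult_right_zero[OF LIMSEQ_power_zero]) simp
  obtain X where
    X: "\<And>n. X n \<in> fitzpatrick_epigraph A \<and> snd (X n) - duality_form (fst (X n)) \<le> e n"
      "\<And>n. norm (fst (X (Suc n)) - fst (X n)) \<le> \<eta> * (1/2)^n"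
      and X0: "X 0 = (b, r)"
  proof -
    have "\<exists>f. \<forall>n. (f n \<in> fitzpatrick_epigraph A \<and> snd (f n) - duality_form (fst (f n)) \<le> e n
        \<and> (n = 0 \<longrightarrow> f n = (b, r))) \<and> norm (fst (f (Suc n)) - fst (f n)) \<le> \<eta> * (1/2)^n"
    proof (rule dependent_nat_choice)
      show "\<exists>x. x \<in> fitzpatrick_epigraph A \<and> snd x - duality_form (fst x) \<le> e 0
          \<and> (0 = (0::nat) \<longrightarrow> x = (b, r))"
        using b by (intro exI[of _ "(b, r)"]) (simp add: e_def)
    next
      fix x n
      assume x: "x \<in> fitzpatrick_epigraph A \<and> snd x - duality_form (fst x) \<le> e n
          \<and> (n = 0 \<longrightarrow> x = (b, r))"
      obtain c t where ct: "(c, t) \<in> fitzpatrick_epigraph A"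
        "t - duality_form c + ((norm (c - fst x))\<^sup>2 / 2 + duality_form (c - fst x)) < e (Suc n)"
        using approx[OF e_pos] by blast
      have nonneg: "0 \<le> (norm (c - fst x))\<^sup>2 / 2 + duality_form (c - fst x)"
        using abs_duality_form_le[of "c - fst x"] by linarith
      have gap: "0 \<le> t - duality_form c" "t - duality_form c \<le> e (Suc n)"
        using duality_form_le_fitzpatrick[OF max ct(1)] ct(2) nonneg by auto
      have "- duality_form (c - fst x) \<le> 2 * (snd x - duality_form (fst x)) + 2 * (t - duality_form c)"
        using gap_controls_duality_form[OF max _ ct(1), of "fst x" "snd x"] x by simp
      then have "(norm (c - fst x))\<^sup>2 \<le> 10 * e n"
        using ct(2) gap conjunct1[OF conjunct2[OF x]] e_Suc[of n] e_pos[of n] by argo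
      also have "\<dots> = (\<eta> * (1/2)^n)\<^sup>2"
      proof -
        have "(1/4 :: real)^n = ((1/2)^n)\<^sup>2"
          by (simp add: power2_eq_square flip: power_mult_distrib)
        then show ?thesis unfolding e_def power_mult_distrib by simp
      qed
      finally have "norm (c - fst x) \<le> \<eta> * (1/2)^n"
        by (rule power2_le_imp_le) (use eta in simp)
      then show "\<exists>y. (y \<in> fitzpatrick_epigraph A \<and> snd y - duality_form (fst y) \<le> e (Suc n)
          \<and> (Suc n = 0 \<longrightarrow> y = (b, r))) \<and> norm (fst y - fst x) \<le> \<eta> * (1/2)^n"
        using ct(1) gap by (intro exI[of _ "(c, t)"]) auto
    qed
    then show thesis using that by blast
  qed
  define u where "u n = fst (X (Suc n)) - fst (X n)" for n
  have geo: "(\<lambda>n. \<eta> * (1/2)^n) sums (\<eta> * 2)"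
    using sums_mult[OF geometric_sums[of "1/2 :: real"], of \<eta>] by simp
  have norm_summable: "summable (\<lambda>n. norm (u n))"
    using X(2) by (intro summable_comparison_test'[OF sums_summable[OF geo]]) (simp add: u_def)
  then have "summable u" by (rule summable_norm_cancel)
  define a where "a = b + suminf u"
  have "(\<lambda>n. b + (\<Sum>k<n. u k)) \<longlonglongrightarrow> a"
    unfolding a_def by (intro tendsto_intros summable_LIMSEQ \<open>summable u\<close>)
  moreover have "b + (\<Sum>k<n. u k) = fst (X n)" for n
    unfolding u_def using sum_lessThan_telescope[of "\<lambda>k. fst (X k)" n] by (simp add: X0)
  ultimately have lim: "(\<lambda>n. fst (X n)) \<longlonglongrightarrow> a" by simp
  have "norm (a - b) \<le> (\<Sum>n. norm (u n))"
    unfolding a_def using summable_norm[OF norm_summable] by simp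
  also have "\<dots> \<le> \<eta> * 2"
    unfolding sums_unique[OF geo] using X(2)
    by (intro suminf_le norm_summable sums_summable[OF geo]) (simp add: u_def)
  finally have near: "norm (a - b) \<le> 2 * \<eta>" by simp
  have "(a, duality_form a) \<in> fitzpatrick_epigraph A"
  proof -
    have "duality_bracket s a - duality_form s \<le> duality_form a + 0" if s: "s \<in> A" for s
    proof (rule LIMSEQ_le)
      show "(\<lambda>n. duality_bracket s (fst (X n)) - duality_form s)
          \<longlonglongrightarrow> duality_bracket s a - duality_form s"
        by (intro tendsto_intros tendsto_duality_bracket lim)
      show "(\<lambda>n. duality_form (fst (X n)) + e n) \<longlonglongrightarrow> duality_form a + 0"
        by (intro tendsto_intros tendsto_duality_form lim e_lim)
      have "duality_bracket s (fst (X n)) - duality_form s \<le> duality_form (fst (X n)) + e n" for n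
        using X(1)[of n] fitzpatrick_epigraphD[of "fst (X n)" "snd (X n)" A s] s by simp
      then show "\<exists>N. \<forall>n\<ge>N. duality_bracket s (fst (X n)) - duality_form s
          \<le> duality_form (fst (X n)) + e n" by blast
    qed
    then show ?thesis by (simp add: fitzpatrick_epigraph_def)
  qed
  then have "a \<in> A" by (rule maximally_monotone_memI[OF max])
  then show ?thesis using near by blast
qed

text \<open>The starting point \<open>c\<close> has a small gap and small \<open>r (c - b)\<close>, and some \<open>a\<close> in \<open>A\<close> is close to
  \<open>c\<close>. Passing from \<open>r (c - b)\<close> to \<open>r (a - b)\<close> costs at most
  \<open>2 \<parallel>c - b\<parallel> \<parallel>a - c\<parallel> + \<parallel>a - c\<parallel>\<^sup>2\<close>, so a bound on \<open>\<parallel>c - b\<parallel>\<close> independent of the accuracy is needed first.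
  It exists because \<open>\<phi> c\<close> is at least
  \<open>[s, c] - q s\<close> for a fixed \<open>s\<close> in \<open>A\<close>, which makes the quantity known to be small grow
  quadratically in \<open>\<parallel>c - b\<parallel>\<close>.\<close>

lemma graph_approximation:
  fixes A :: "('a::banach \<times> 'a dual) set"
  assumes max: "maximally_monotone_set A"
    and approx: "\<And>b e. 0 < e \<Longrightarrow> \<exists>c t. (c, t) \<in> fitzpatrick_epigraph A \<and>
      t - duality_form c + ((norm (c - b))\<^sup>2 / 2 + duality_form (c - b)) < e"
    and e: "0 < e"
  shows "\<exists>a\<in>A. (norm (a - b))\<^sup>2 / 2 + duality_form (a - b) < e"
proof -
  obtain s where s: "s \<in> A" using maximally_monotone_nonempty[OF max] by auto
  define k where "k = norm (s - b)"
  \<comment> \<open>\<open>K\<close> bounds the solutions \<open>n\<close> of \<open>n\<^sup>2 / 2 \<le> 1 + k n + k\<^sup>2 / 2\<close>, the inequality that \<open>\<parallel>c - b\<parallel>\<close>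
    will satisfy.\<close>
  define K where "K = k + sqrt (k\<^sup>2 + 2 * (1 + k\<^sup>2 / 2))"
  have K: "0 \<le> K" by (simp add: K_def k_def)
  \<comment> \<open>The final estimate is \<open>r (a - b) \<le> \<eta> + 4 K \<eta> + 4 \<eta>\<close>.\<close>
  define \<eta> where "\<eta> = min 1 (e / (2 * (5 + 4 * K)))"
  have eta: "0 < \<eta>" "\<eta> \<le> 1"
    using e K by (auto simp: \<eta>_def)
  have "\<eta> * (5 + 4 * K) \<le> e / (2 * (5 + 4 * K)) * (5 + 4 * K)"
    using K by (intro mult_right_mono) (auto simp: \<eta>_def)
  also have "\<dots> = e / 2"
  proof -
    have "5 + 4 * K \<noteq> 0" using K by linarith
    then show ?thesis by (metis divide_divide_eq_left nonzero_eq_divide_eq)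
  qed
  finally have eta_e: "\<eta> * (5 + 4 * K) \<le> e / 2" .
  have sq: "\<eta>\<^sup>2 \<le> \<eta>" using eta by (simp add: power2_eq_square mult_left_le)
  obtain c t where ct: "(c, t) \<in> fitzpatrick_epigraph A"
    "t - duality_form c + ((norm (c - b))\<^sup>2 / 2 + duality_form (c - b)) < \<eta>\<^sup>2 / 10"
    using approx[of "\<eta>\<^sup>2 / 10" b] eta by auto
  have nonneg: "0 \<le> (norm (c - b))\<^sup>2 / 2 + duality_form (c - b)"
    using abs_duality_form_le[of "c - b"] by linarith
  have gap: "t - duality_form c \<le> \<eta>\<^sup>2 / 10" "0 \<le> t - duality_form c"
    using ct nonneg duality_form_le_fitzpatrick[OF max ct(1)] by auto
  have far: "norm (c - b) \<le> K"
  proof -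
    define n where "n = norm (c - b)"
    have "duality_bracket s c - duality_form s \<le> t" by (rule fitzpatrick_epigraphD[OF ct(1) s])
    then have "duality_bracket (s - b) (c - b) - duality_form (s - b) + (norm (c - b))\<^sup>2 / 2
        \<le> t - duality_form c + ((norm (c - b))\<^sup>2 / 2 + duality_form (c - b))"
      by (simp add: duality_form_diff duality_bracket_linear duality_bracket_commute
          duality_bracket_self)
    also have "\<dots> \<le> 1" using ct(2) sq eta by linarith
    finally have "n\<^sup>2 / 2 \<le> 1 + k * n + k\<^sup>2 / 2"
      using abs_duality_bracket_le[of "s - b" "c - b"] abs_duality_form_le[of "s - b"]
      unfolding k_def n_def by linarith
    then have "(n - k)\<^sup>2 \<le> k\<^sup>2 + 2 * (1 + k\<^sup>2 / 2)"
      by (simp add: power2_diff mult.commute)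
    then have "n - k \<le> sqrt (k\<^sup>2 + 2 * (1 + k\<^sup>2 / 2))" by (rule real_le_rsqrt)
    then show ?thesis by (simp add: K_def n_def)
  qed
  obtain a where a: "a \<in> A" "norm (a - c) \<le> 2 * \<eta>"
    using small_gap_near_graph[OF max approx eta(1) ct(1) gap(1)] by blast
  define u v where "u = c - b" and "v = a - c"
  have ab: "a - b = u + v" by (simp add: u_def v_def)
  have "norm u * norm v \<le> K * (2 * \<eta>)"
    using far a(2) K unfolding u_def v_def by (intro mult_mono) auto
  moreover have "(norm v)\<^sup>2 \<le> 4 * \<eta>"
  proof -
    have "(norm v)\<^sup>2 \<le> (2 * \<eta>)\<^sup>2" using a(2) unfolding v_def by (intro power_mono) auto
    then show ?thesis using sq by (simp add: power_mult_distrib)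
  qed
  moreover have "(norm (u + v))\<^sup>2 \<le> (norm u)\<^sup>2 + 2 * (norm u * norm v) + (norm v)\<^sup>2"
  proof -
    have "(norm (u + v))\<^sup>2 \<le> (norm u + norm v)\<^sup>2"
      by (intro power_mono norm_triangle_ineq) auto
    then show ?thesis by (simp add: power2_sum)
  qed
  moreover have "duality_form (u + v) \<le> duality_form u + norm u * norm v + (norm v)\<^sup>2 / 2"
    using abs_duality_form_le[of v] abs_duality_bracket_le[of u v] unfolding duality_form_add
    by linarith
  moreover have "(norm u)\<^sup>2 / 2 + duality_form u \<le> \<eta>"
    using ct(2) gap sq unfolding u_def by linarith
  ultimately have "(norm (u + v))\<^sup>2 / 2 + duality_form (u + v) \<le> \<eta> * (5 + 4 * K)"
    by (simp add: algebra_simps)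
  then show ?thesis using a(1) eta_e e ab by (intro bexI[of _ a]) auto
qed

section \<open>The criterion\<close>

lemma quasidense_iff:
  "quasidense S \<longleftrightarrow>
    (\<forall>b e. 0 < e \<longrightarrow> (\<exists>a\<in>graph_of S. (norm (a - b))\<^sup>2 / 2 + duality_form (a - b) < e))"
proof -
  have "(INF (s, g) \<in> graph_of S. ereal ((norm (s - x))\<^sup>2 / 2 + (norm (g - f))\<^sup>2 / 2 + \<langle>s - x, g - f\<rangle>)) \<le> 0
    \<longleftrightarrow> (\<forall>e>0. \<exists>a\<in>graph_of S. (norm (a - (x, f)))\<^sup>2 / 2 + duality_form (a - (x, f)) < e)"
    (is "?I \<le> 0 \<longleftrightarrow> ?R") for x f
  proof -
    have eq: "?I = (INF a \<in> graph_of S. ereal ((norm (a - (x, f)))\<^sup>2 / 2 + duality_form (a - (x, f))))"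
      by (intro INF_cong) (auto simp: norm_prod_sq duality_form_def add_divide_distrib)
    have "?I \<le> 0 \<longleftrightarrow> (\<forall>e>0. ?I < ereal e)"
    proof
      assume "\<forall>e>0. ?I < ereal e"
      then have "?I \<le> 0 + ereal e" if "0 < e" for e using that by (simp add: less_imp_le)
      then show "?I \<le> 0" by (rule ereal_le_epsilon2)
    next
      assume "?I \<le> 0"
      then show "\<forall>e>0. ?I < ereal e" by (auto intro: le_less_trans)
    qed
    then show ?thesis unfolding eq by (simp add: INF_less_iff)
  qed
  then show ?thesis unfolding quasidense_def by auto
qed

lemma fenchel_conjugate_ge_graph:
  assumes mono: "monotone_set (graph_of S)" and s: "s \<in> graph_of S"
  shows "ereal (\<langle>fst s, f\<rangle> + \<langle>snd s, F\<rangle> - duality_form s) \<le> fenchel_conjugate (fitzpatrick S) f F"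
proof -
  have "fitzpatrick S (fst s) (snd s) \<le> ereal (duality_form s)"
    using monotone_graph_in_epigraph[OF mono s] by (simp add: fitzpatrick_le_iff)
  then have "ereal (\<langle>fst s, f\<rangle> + \<langle>snd s, F\<rangle>) - ereal (duality_form s)
      \<le> ereal (\<langle>fst s, f\<rangle> + \<langle>snd s, F\<rangle>) - fitzpatrick S (fst s) (snd s)"
    by (intro ereal_minus_mono) auto
  also have "\<dots> \<le> fenchel_conjugate (fitzpatrick S) f F"
    unfolding fenchel_conjugate_def by (intro SUP_upper2[of s]) (auto split: prod.split)
  finally show ?thesis by simp
qed

text \<open>The test point \<open>(0, f - z)\<close> stands in for a preimage of \<open>(f, F)\<close>, which need not exist since
  \<open>F\<close> need not come from \<open>E\<close>: the first component is left at \<open>0\<close>, and \<open>z\<close> compensates by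
  making \<open>\<langle>z, F\<rangle> + \<parallel>z\<parallel>\<^sup>2 / 2 + \<parallel>F\<parallel>\<^sup>2 / 2\<close> small.\<close>

lemma quasidense_imp_conjugate_ge:
  assumes mono: "monotone_set (graph_of S)" and qd: "quasidense S"
  shows "ereal \<langle>f, F\<rangle> \<le> fenchel_conjugate (fitzpatrick S) f F"
proof (rule ereal_le_epsilon2)
  fix e :: real assume e: "0 < e"
  obtain z where z: "(norm z)\<^sup>2 / 2 + F z \<le> - (norm F)\<^sup>2 / 2 + e / 2"
    using conjugate_half_norm_sq_approx[of "e / 2" F] e by auto
  obtain a where a: "a \<in> graph_of S"
    "(norm (a - (0, f - z)))\<^sup>2 / 2 + duality_form (a - (0, f - z)) < e / 2"
    using qd e unfolding quasidense_iff by (meson half_gt_zero)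
  define x where "x = fst a"
  define w where "w = snd a - (f - z)"
  have snd_a: "snd a = w + f - z" by (simp add: w_def)
  have "(norm x)\<^sup>2 / 2 + (norm w)\<^sup>2 / 2 + w x < e / 2"
    using a(2) by (simp add: norm_prod_sq duality_form_def pairing_def x_def w_def add_divide_distrib)
  moreover have "- (norm z)\<^sup>2 / 2 \<le> (norm x)\<^sup>2 / 2 + z x"
    by (rule conjugate_half_norm_sq_lower)
  moreover have "- (norm F)\<^sup>2 / 2 \<le> (norm w)\<^sup>2 / 2 + F w"
    by (rule conjugate_half_norm_sq_lower)
  ultimately have "F f - e \<le> z x - w x + F w + F f - F z"
    using z by linarith
  also have "\<dots> = \<langle>fst a, f\<rangle> + \<langle>snd a, F\<rangle> - duality_form a"
    by (simp add: duality_form_def pairing_def snd_a blinfun.add_left blinfun.add_right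
        blinfun.diff_left blinfun.diff_right flip: x_def)
  finally have "ereal (F f) \<le> ereal (\<langle>fst a, f\<rangle> + \<langle>snd a, F\<rangle> - duality_form a) + ereal e"
    by simp
  also have "\<dots> \<le> fenchel_conjugate (fitzpatrick S) f F + ereal e"
    by (intro add_right_mono fenchel_conjugate_ge_graph[OF mono a(1)])
  finally show "ereal \<langle>f, F\<rangle> \<le> fenchel_conjugate (fitzpatrick S) f F + ereal e"
    by (simp add: pairing_def)
qed

lemma fenchel_conjugate_leI:
  assumes ne: "graph_of S \<noteq> {}"
    and le: "\<And>x g r. ((x, g), r) \<in> fitzpatrick_epigraph (graph_of S) \<Longrightarrow>
      \<langle>x, f\<rangle> + \<langle>g, F\<rangle> - r \<le> M"
  shows "fenchel_conjugate (fitzpatrick S) f F \<le> ereal M"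
  unfolding fenchel_conjugate_def
proof (clarsimp simp: SUP_le_iff)
  fix x g
  have "fitzpatrick S x g \<noteq> - \<infinity>"
  proof -
    obtain s where "s \<in> graph_of S" using ne by auto
    then have "ereal (\<langle>fst s, g\<rangle> + \<langle>x, snd s\<rangle> - \<langle>fst s, snd s\<rangle>) \<le> fitzpatrick S x g"
      unfolding fitzpatrick_def by (intro SUP_upper2[of s]) (auto split: prod.split)
    then show ?thesis by auto
  qed
  then show "ereal (\<langle>x, f\<rangle> + \<langle>g, F\<rangle>) - fitzpatrick S x g \<le> ereal M"
  proof (cases "fitzpatrick S x g")
    case (real r)
    then have "((x, g), r) \<in> fitzpatrick_epigraph (graph_of S)"
      by (simp flip: fitzpatrick_le_iff)
    then show ?thesis using le real by simp
  qed auto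
qed

definition canonical_bidual :: "'a::real_normed_vector \<Rightarrow> 'a dual dual"
  where "canonical_bidual x = Blinfun (\<lambda>g. blinfun_apply g x)"

lemma canonical_bidual_apply [simp]: "blinfun_apply (canonical_bidual x) g = blinfun_apply g x"
  unfolding canonical_bidual_def
  by (simp add: bounded_linear_Blinfun_apply
      bounded_bilinear.bounded_linear_left[OF bounded_bilinear_blinfun_apply])

text \<open>If the infimum were at least \<open>e\<close>, duality would give a functional \<open>c = (y, Y)\<close> on
  \<open>E \<times> E\<^sup>*\<close>. Its translate \<open>(f, F)\<close> by \<open>[b, \<cdot>]\<close> violates the hypothesis: choosing both components
  of \<open>u = (x, g)\<close> almost minimal bounds the conjugate at \<open>(f, F)\<close> by \<open>\<langle>f, F\<rangle> - e / 2\<close>.\<close>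

lemma conjugate_ge_imp_approx:
  assumes max: "maximally_monotone_set (graph_of S)"
    and conj: "\<And>f F. ereal \<langle>f, F\<rangle> \<le> fenchel_conjugate (fitzpatrick S) f F"
    and e: "0 < e"
  shows "\<exists>c t. (c, t) \<in> fitzpatrick_epigraph (graph_of S) \<and>
      t - duality_form c + ((norm (c - b))\<^sup>2 / 2 + duality_form (c - b)) < e"
proof (rule ccontr)
  assume "\<not> ?thesis"
  then have far: "e \<le> t - duality_form c + ((norm (c - b))\<^sup>2 / 2 + duality_form (c - b))"
    if "(c, t) \<in> fitzpatrick_epigraph (graph_of S)" for c t
    using that not_less by blast
  \<comment> \<open>Translating the graph by \<open>- b\<close> turns the assumption into a bound on a convex function plus
    \<open>\<parallel>\<cdot>\<parallel>\<^sup>2 / 2\<close>, since the \<open>q\<close>-terms cancel.\<close>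
  define C where "C = fitzpatrick_epigraph ((\<lambda>s. s - b) ` graph_of S)"
  have C_iff: "(d, r) \<in> C \<longleftrightarrow>
      (d + b, r + duality_bracket d b + duality_form b) \<in> fitzpatrick_epigraph (graph_of S)" for d r
    unfolding C_def fitzpatrick_epigraph_def
    by (simp add: duality_form_diff duality_bracket_linear duality_bracket_commute[of b]
        duality_bracket_self algebra_simps)
  have ne: "graph_of S \<noteq> {}" by (rule maximally_monotone_nonempty[OF max])
  have "C \<noteq> {}"
  proof -
    have mono: "monotone_set (graph_of S)" using max by (simp add: maximally_monotone_set_def)
    obtain s where "s \<in> graph_of S" using ne by auto
    from monotone_graph_in_epigraph[OF mono this]
    have "(s - b, duality_form s - duality_bracket (s - b) b - duality_form b) \<in> C"
      by (simp add: C_iff)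
    then show ?thesis by auto
  qed
  moreover have "e \<le> r + (norm d)\<^sup>2 / 2" if "(d, r) \<in> C" for d r
    using far[OF that[unfolded C_iff]] by (simp add: duality_form_add)
  moreover have "convex C" unfolding C_def by (rule convex_fitzpatrick_epigraph)
  ultimately have "\<exists>c :: ('a \<times> 'a dual) \<Rightarrow>\<^sub>L real.
      \<forall>(d, r)\<in>C. \<forall>u. e \<le> r - c d + ((norm u)\<^sup>2 / 2 + c u)"
    by (intro half_norm_sq_duality)
  then obtain c :: "('a \<times> 'a dual) \<Rightarrow>\<^sub>L real" where
    c: "\<And>d r u. (d, r) \<in> C \<Longrightarrow> e \<le> r - c d + ((norm u)\<^sup>2 / 2 + c u)"
    by blast
  define y where "y = Blinfun (\<lambda>x. c (x, 0))"
  define Y where "Y = Blinfun (\<lambda>g. c (0, g))"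
  have y: "blinfun_apply y x = c (x, 0)" for x
    unfolding y_def by (subst bounded_linear_Blinfun_apply) (auto intro!: bounded_linear_intros)
  have Y: "blinfun_apply Y g = c (0, g)" for g
    unfolding Y_def by (subst bounded_linear_Blinfun_apply) (auto intro!: bounded_linear_intros)
  have split: "c (x, g) = y x + Y g" for x g
    using blinfun.add_right[of c "(x, 0)" "(0, g)"] by (simp add: y Y)
  obtain x where x: "(norm x)\<^sup>2 / 2 + y x \<le> - (norm y)\<^sup>2 / 2 + e / 4"
    using conjugate_half_norm_sq_approx[of "e / 4" y] e by auto
  obtain g where g: "(norm g)\<^sup>2 / 2 + Y g \<le> - (norm Y)\<^sup>2 / 2 + e / 4"
    using conjugate_half_norm_sq_approx[of "e / 4" Y] e by auto
  have "- (norm Y)\<^sup>2 / 2 \<le> (norm y)\<^sup>2 / 2 + Y y" by (rule conjugate_half_norm_sq_lower)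
  with x g have "(norm x)\<^sup>2 / 2 + (norm g)\<^sup>2 / 2 + (y x + Y g) \<le> Y y + e / 2"
    by argo
  then have u: "(norm (x, g))\<^sup>2 / 2 + c (x, g) \<le> Y y + e / 2"
    by (simp add: split norm_prod_sq add_divide_distrib)
  define f where "f = y + snd b"
  define F where "F = Y + canonical_bidual (fst b)"
  have "fenchel_conjugate (fitzpatrick S) f F \<le> ereal (Y y + c b + duality_form b - e / 2)"
  proof (rule fenchel_conjugate_leI[OF ne])
    fix x' g' r
    assume r: "((x', g'), r) \<in> fitzpatrick_epigraph (graph_of S)"
    define p where "p = (x', g')"
    have "(p - b, r - duality_bracket (p - b) b - duality_form b) \<in> C"
      using r by (simp add: C_iff p_def)
    from c[OF this, of "(x, g)"] u
    have "c p + duality_bracket p b - r \<le> Y y + c b + duality_form b - e / 2"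
      by (simp add: blinfun.diff_right duality_bracket_linear duality_bracket_self)
    moreover have "\<langle>x', f\<rangle> + \<langle>g', F\<rangle> = c p + duality_bracket p b"
      by (simp add: f_def F_def p_def pairing_def duality_bracket_def split blinfun.add_left)
    ultimately show "\<langle>x', f\<rangle> + \<langle>g', F\<rangle> - r \<le> Y y + c b + duality_form b - e / 2" by simp
  qed
  moreover have "\<langle>f, F\<rangle> = Y y + c b + duality_form b"
    using split[of "fst b" "snd b"]
    by (simp add: f_def F_def pairing_def duality_form_def blinfun.add_left blinfun.add_right)
  ultimately have "ereal \<langle>f, F\<rangle> \<le> ereal (\<langle>f, F\<rangle> - e / 2)"
    by (metis conj order_trans)
  then show False using e by simp
qed

theorem theorem6p7:
  fixes S :: "'a::banach multifun"
  assumes nonzero: "\<exists>x::'a. x \<noteq> 0"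
    and S: "maximally_monotone S"
  shows "quasidense S \<longleftrightarrow>
    (\<forall>(f :: 'a dual) (F :: 'a dual dual). fenchel_conjugate (fitzpatrick S) f F \<ge> ereal \<langle>f, F\<rangle>)"
proof
  have max: "maximally_monotone_set (graph_of S)"
    using S by (simp add: maximally_monotone_def)
  {
    assume "quasidense S"
    then show "\<forall>(f :: 'a dual) F. ereal \<langle>f, F\<rangle> \<le> fenchel_conjugate (fitzpatrick S) f F"
      using max quasidense_imp_conjugate_ge by (auto simp: maximally_monotone_set_def)
  next
    assume "\<forall>(f :: 'a dual) F. ereal \<langle>f, F\<rangle> \<le> fenchel_conjugate (fitzpatrick S) f F"
    then show "quasidense S"
      unfolding quasidense_iff using graph_approximation[OF max] conjugate_ge_imp_approx[OF max]
      by blast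
  }
qed

end
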